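(* Let $E=\{\mathbf{a}_1,\ldots,\mathbf{a}_m\}\subset\mathbb{R}^n$ be a finite set of points whose affine span is a hyperplane $H$ of $\mathbb{R}^n$ not containing the origin $\mathbf{0}$. Let $\Delta=[E]$ be the convex hull of $E$ and let $\Gamma(\Delta)$ be the corresponding pyramid. Then the following conditions are equivalent: 1. There exists a finite sequence of monomial blowing-ups such that the transform of $\Gamma(\Delta)$ by the sequence is contained in the first quadrant $\mathbb{R}_0^n$. 2. $\Gamma(\Delta)\cap(-\mathbb{R}_0^n)=\{\mathbf{0}\}$.
   Context: $\mathbb{R}_0$ denotes the set of non-negative real numbers. The first quadrant is $\mathbb{R}_0^n$ (vectors with all coordinates $\ge 0$), and $-\mathbb{R}_0^n$ is the set of vectors with all coordinates $\le 0$. For $\Delta=[E]$ with $E=\{\mathbf{a}_1,\ldots,\mathbf{a}_m\}$ generating (i.e. having as affine span) a hyperplane not passing through $\mathbf{0}$, the pyramid is $$\Gamma(\Delta)=\bigcup_{\mathbf{a}\in\Delta}\{\lambda\mathbf{a}\mid\lambda\ge 0\}=\Big\{\sum_{i=1}^m\lambda_i\mathbf{a}_i \;\Big|\; \lambda_i\ge 0\ \text{for all } i=1,\ldots,m\Big\}.$$ A monomial blowing-up is a linear automorphism $\varphi_{ij}$ of $\mathbb{R}^n$ of the form $(a_1,\ldots,a_n)\mapsto(a_1,\ldots,a_n)M_{ij}$ (row vectors), where $i\ne j$, $1\le i,j\le n$, and $M_{ij}$ is the $n\times n$ identity matrix with its $(i,j)$-entry replaced by $1$; that is, $\varphi_{ij}$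 replaces the $j$-th coordinate $a_j$ by $a_i+a_j$ and leaves the other coordinates unchanged. The transform of a pyramid by a finite (possibly empty) sequence of monomial blowing-ups is its image under their composition. *)

theory Defs
  imports "HOL-Analysis.Analysis"
begin

definition is_hyperplane :: "(real ^ 'n) set \<Rightarrow> bool" where
  "is_hyperplane H \<longleftrightarrow> (\<exists>c b. c \<noteq> 0 \<and> H = {x. c \<bullet> x = b})"

definition first_quadrant :: "(real ^ 'n) set" where
  "first_quadrant = {x. \<forall>i. 0 \<le> x $ i}"

definition pyramid :: "(real ^ 'n) set \<Rightarrow> (real ^ 'n) set" where
  "pyramid \<Delta> = (\<Union>a\<in>\<Delta>. {t *\<^sub>R a | t. 0 \<le> t})"

lemma pyramid_eq_conic_hull: "pyramid \<Delta> = conic hull \<Delta>"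
  unfolding pyramid_def conic_hull_explicit by blast

lemma pyramid_convex_hull_finite:
  fixes E :: "(real ^ 'n) set"
  assumes "finite E" "E \<noteq> {}"
  shows "pyramid (convex hull E) = {\<Sum>a\<in>E. u a *\<^sub>R a | u. \<forall>a\<in>E. 0 \<le> u a}"
proof (intro set_eqI iffI)
  fix x assume "x \<in> pyramid (convex hull E)"
  then obtain t u where t: "0 \<le> t" and u: "\<forall>a\<in>E. 0 \<le> u a"
    and x: "x = t *\<^sub>R (\<Sum>a\<in>E. u a *\<^sub>R a)"
    unfolding pyramid_def convex_hull_finite[OF assms(1)] by auto
  have "x = (\<Sum>a\<in>E. (t * u a) *\<^sub>R a)"
    unfolding x by (simp add: scaleR_sum_right)
  with t u show "x \<in> {\<Sum>a\<in>E. u a *\<^sub>R a | u. \<forall>a\<in>E. 0 \<le> u a}"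
    by (intro CollectI exI[of _ "\<lambda>a. t * u a"]) simp
next
  fix x assume "x \<in> {\<Sum>a\<in>E. u a *\<^sub>R a | u. \<forall>a\<in>E. 0 \<le> u a}"
  then obtain u where u: "\<forall>a\<in>E. 0 \<le> u a" and x: "x = (\<Sum>a\<in>E. u a *\<^sub>R a)"
    by blast
  show "x \<in> pyramid (convex hull E)"
  proof (cases "sum u E = 0")
    case True
    then have "\<forall>a\<in>E. u a = 0"
      using u assms(1) by (simp add: sum_nonneg_eq_0_iff)
    then have "x = 0" by (simp add: x)
    moreover obtain a where "a \<in> convex hull E"
      using assms(2) hull_inc by fastforce
    ultimately show ?thesis
      unfolding pyramid_def by force
  next
    case False
    with u have pos: "0 < sum u E"
      by (simp add: less_le sum_nonneg)
    let ?v = "\<lambda>a. u a / sum u E"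
    have "(\<Sum>a\<in>E. ?v a *\<^sub>R a) \<in> convex hull E"
      unfolding convex_hull_finite[OF assms(1)]
      using u pos by (intro CollectI exI[of _ ?v]) (simp add: sum_divide_distrib[symmetric])
    moreover have "x = sum u E *\<^sub>R (\<Sum>a\<in>E. ?v a *\<^sub>R a)"
      using pos by (simp add: x scaleR_sum_right)
    ultimately show ?thesis
      unfolding pyramid_def using pos by (auto intro!: less_imp_le)
  qed
qed

definition blowup_matrix :: "'n \<Rightarrow> 'n \<Rightarrow> real ^ 'n ^ 'n" where
  "blowup_matrix i j = (\<chi> k l. if k = i \<and> l = j then 1 else mat 1 $ k $ l)"

text \<open>Vectors are row vectors, so the matrix acts from the right.\<close>

definition monomial_blowup :: "'n::finite \<Rightarrow> 'n \<Rightarrow> real ^ 'n \<Rightarrow> real ^ 'n" where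
  "monomial_blowup i j a = a v* blowup_matrix i j"

lemma monomial_blowup_nth:
  fixes a :: "real ^ 'n"
  assumes "i \<noteq> j"
  shows "monomial_blowup i j a $ k = (if k = j then a $ i + a $ j else a $ k)"
proof (cases "k = j")
  case True
  have "monomial_blowup i j a $ j
      = (\<Sum>l\<in>UNIV. (if l = i then a $ l else 0) + (if l = j then a $ l else 0))"
    unfolding monomial_blowup_def blowup_matrix_def vector_matrix_mult_def mat_def
    using assms by (auto intro!: sum.cong)
  with True show ?thesis by (simp add: sum.distrib)
next
  case False
  have "monomial_blowup i j a $ k = (\<Sum>l\<in>UNIV. if l = k then a $ l else 0)"
    unfolding monomial_blowup_def blowup_matrix_def vector_matrix_mult_def mat_def
    using False by (simp add: if_distrib[of "\<lambda>x. _ * x"] cong: if_cong)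
  with False show ?thesis by simp
qed

text \<open>A finite sequence of monomial blowing-ups is the list of its index pairs; its head is
  applied first.\<close>

definition blowup_sequence :: "('n \<times> 'n) list \<Rightarrow> bool" where
  "blowup_sequence ps \<longleftrightarrow> (\<forall>(i, j)\<in>set ps. i \<noteq> j)"

definition blowup_transform ::
    "('n::finite \<times> 'n) list \<Rightarrow> (real ^ 'n) set \<Rightarrow> (real ^ 'n) set" where
  "blowup_transform ps S = fold (\<lambda>(i, j). monomial_blowup i j) ps ` S"

end

theory Submission
  imports Defs
begin

text \<open>
  A blowing-up \<open>\<phi>\<^sub>i\<^sub>j\<close> preserves the pairing \<open>\<Sum>\<^sub>k w\<^sub>k a\<^sub>k\<close> when it is accompanied by the dual
  substitution \<open>w\<^sub>i := w\<^sub>i - w\<^sub>j\<close>. If the pyramid meets the negative quadrant only in the origin,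
  separating \<open>\<Delta>\<close> from that quadrant and rounding gives a natural weight vector \<open>w\<close> that is positive
  on \<open>E\<close>. The Euclidean algorithm, run on \<open>w\<close>, reduces it to a single non-zero entry \<open>w\<^sub>k\<close>; then
  \<open>a\<^sub>k > 0\<close> on \<open>E\<close>, and adding the \<open>k\<close>-th coordinate often enough to the others makes them
  non-negative. Conversely, a blowing-up maps non-zero non-positive vectors to such vectors.
\<close>

abbreviation blowups :: "('n::finite \<times> 'n) list \<Rightarrow> real ^ 'n \<Rightarrow> real ^ 'n" where
  "blowups \<equiv> fold (\<lambda>(i, j). monomial_blowup i j)"

lemma blowup_sequence_simps [simp]:
  "blowup_sequence []"
  "blowup_sequence ((i, j) # ps) \<longleftrightarrow> i \<noteq> j \<and> blowup_sequence ps"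
  "blowup_sequence (ps @ qs) \<longleftrightarrow> blowup_sequence ps \<and> blowup_sequence qs"
  by (auto simp: blowup_sequence_def)

lemma linear_monomial_blowup: "linear (monomial_blowup i j)"
  unfolding monomial_blowup_def
  by (rule linearI) (simp_all add: vector_matrix_left_distrib scaleR_vector_matrix_assoc)

lemma linear_blowups: "linear (blowups ps)"
proof (induction ps)
  case (Cons p ps)
  then have "linear (blowups ps \<circ> monomial_blowup (fst p) (snd p))"
    by (intro linear_compose linear_monomial_blowup)
  then show ?case by (cases p) (simp add: o_def)
qed (simp add: id_def linear_ident)

lemma blowup_sequence_replicate: "i \<noteq> j \<Longrightarrow> blowup_sequence (replicate N (i, j))"
  by (auto simp: blowup_sequence_def)

lemma blowups_replicate_nth:
  assumes "i \<noteq> j"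
  shows "blowups (replicate N (i, j)) a $ l = (if l = j then real N * a $ i + a $ j else a $ l)"
  using assms
  by (induction N arbitrary: a) (auto simp: monomial_blowup_nth algebra_simps)

text \<open>On a non-positive vector each blowing-up only adds a non-positive number to a
  coordinate, so a negative coordinate stays negative and the image cannot vanish.\<close>

lemma blowups_nonpos:
  assumes "blowup_sequence ps" "\<forall>l. x $ l \<le> 0" "x \<noteq> 0"
  shows "(\<forall>l. blowups ps x $ l \<le> 0) \<and> blowups ps x \<noteq> 0"
  using assms
proof (induction ps arbitrary: x)
  case (Cons p ps)
  obtain i j where p: "p = (i, j)" by fastforce
  with Cons.prems have ij: "i \<noteq> j" "blowup_sequence ps" by auto
  let ?y = "monomial_blowup i j x"
  have nonpos: "\<forall>l. ?y $ l \<le> 0"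
    using Cons.prems(2) ij(1) by (simp add: monomial_blowup_nth add_nonpos_nonpos)
  obtain l where l: "x $ l < 0"
    using Cons.prems(2,3) by (metis less_eq_real_def vec_eq_iff zero_index)
  have "?y $ l < 0"
    using l Cons.prems(2) ij(1) by (auto simp: monomial_blowup_nth add_nonpos_neg)
  then have "?y \<noteq> 0" by auto
  with Cons.IH[OF ij(2) nonpos] show ?case by (simp add: p)
qed auto

text \<open>The other coordinates are repaired one at a time by adding the \<open>k\<close>-th
  coordinate to them; since \<open>E\<close> is finite, one number of repetitions serves all its
  points.\<close>

lemma blowups_nonneg_if_coordinate_pos:
  fixes E :: "(real ^ 'n) set"
  assumes "finite E" "\<forall>a\<in>E. 0 < a $ k"
  shows "\<exists>ps. blowup_sequence ps \<and> blowups ps ` E \<subseteq> first_quadrant"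
proof -
  \<comment> \<open>\<open>J\<close> collects the coordinates repaired so far. Outside
    \<open>J\<close> the values must be the original ones, so that \<open>a $ k\<close> and
    \<open>a $ j\<close> are still known when \<open>j\<close> is treated.\<close>
  have "\<exists>ps. blowup_sequence ps \<and>
      (\<forall>a\<in>E. \<forall>l. if l \<in> J then 0 \<le> blowups ps a $ l else blowups ps a $ l = a $ l)"
    if "k \<notin> J" for J
    using finite[of J] that
  proof (induction J)
    case empty
    show ?case by (rule exI[of _ "[]"]) simp
  next
    case (insert j J)
    then obtain ps where ps: "blowup_sequence ps"
      "\<forall>a\<in>E. \<forall>l. if l \<in> J then 0 \<le> blowups ps a $ l else blowups ps a $ l = a $ l" by auto
    have "\<exists>N::nat. \<forall>a\<in>E. 0 \<le> real N * a $ k + a $ j"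
    proof (cases "E = {}")
      case False
      obtain N :: nat where N: "Max ((\<lambda>a. - a $ j / a $ k) ` E) \<le> real N"
        using real_arch_simple by blast
      have "0 \<le> real N * a $ k + a $ j" if "a \<in> E" for a
      proof -
        have "- a $ j / a $ k \<le> real N"
          using N that assms(1) by (meson Max_ge finite_imageI imageI order_trans)
        then show ?thesis using assms(2) that pos_divide_le_eq[of "a $ k" "- a $ j"] by fastforce
      qed
      then show ?thesis by blast
    qed simp
    then obtain N :: nat where N: "\<forall>a\<in>E. 0 \<le> real N * a $ k + a $ j" by blast
    have kj: "k \<noteq> j" using insert.prems by auto
    show ?case
    proof (intro exI conjI ballI allI)
      show "blowup_sequence (ps @ replicate N (k, j))"
        using ps(1) kj by (simp add: blowup_sequence_replicate)
      fix a l assume a: "a \<in> E"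
      have "blowups ps a $ m = a $ m" if "m \<notin> J" for m
        using bspec[OF ps(2) a] that by metis
      then have "blowups ps a $ k = a $ k" "blowups ps a $ j = a $ j"
        using insert.prems insert.hyps(2) by auto
      then show "if l \<in> insert j J then 0 \<le> blowups (ps @ replicate N (k, j)) a $ l
          else blowups (ps @ replicate N (k, j)) a $ l = a $ l"
        using a ps(2) N kj by (simp add: blowups_replicate_nth del: fold_replicate)
    qed
  qed
  from this[of "UNIV - {k}"] obtain ps where ps: "blowup_sequence ps"
    "\<forall>a\<in>E. \<forall>l. if l \<in> UNIV - {k} then 0 \<le> blowups ps a $ l else blowups ps a $ l = a $ l"
    by auto
  have "0 \<le> blowups ps a $ l" if "a \<in> E" for a l
    using ps(2) assms(2) that by (cases "l = k") (auto simp: less_imp_le)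
  with ps(1) show ?thesis by (auto simp: first_quadrant_def)
qed

text \<open>Subtractive Euclidean algorithm: induction on the total weight, with \<open>E\<close>
  generalised because each step replaces it by its image under a blowing-up.\<close>

lemma blowups_nonneg_if_weight_pos:
  fixes E :: "(real ^ 'n) set" and w :: "'n \<Rightarrow> nat"
  assumes "finite E" "\<forall>a\<in>E. 0 < (\<Sum>l\<in>UNIV. real (w l) * a $ l)"
  shows "\<exists>ps. blowup_sequence ps \<and> blowups ps ` E \<subseteq> first_quadrant"
  using assms
proof (induction "\<Sum>l\<in>UNIV. w l" arbitrary: w E rule: less_induct)
  case less
  show ?case
  proof (cases "\<exists>i j. i \<noteq> j \<and> 0 < w j \<and> w j \<le> w i")
    case True
    then obtain i j where ij: "i \<noteq> j" "0 < w j" "w j \<le> w i" by blast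
    \<comment> \<open>Truncated subtraction is exact here because \<open>w j \<le> w i\<close>; the
      total drops because \<open>0 < w j\<close>.\<close>
    define v where "v = w(i := w i - w j)"
    have "(\<Sum>l\<in>UNIV. v l) < (\<Sum>l\<in>UNIV. w l)"
      using ij by (intro sum_strict_mono_ex1) (auto simp: v_def)
    moreover have "\<forall>b\<in>monomial_blowup i j ` E. 0 < (\<Sum>l\<in>UNIV. real (v l) * b $ l)"
    proof safe
      fix a assume a: "a \<in> E"
      \<comment> \<open>The pairing is invariant: the term \<open>w j * a $ i\<close> lost at index
        \<open>i\<close> reappears at index \<open>j\<close>.\<close>
      have "(\<Sum>l\<in>UNIV. real (v l) * monomial_blowup i j a $ l)
        = (\<Sum>l\<in>UNIV. real (w l) * a $ l - (if l = i then real (w j) * a $ i else 0)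
            + (if l = j then real (w j) * a $ i else 0))"
        using ij by (intro sum.cong)
          (auto simp: v_def monomial_blowup_nth algebra_simps)
      also have "\<dots> = (\<Sum>l\<in>UNIV. real (w l) * a $ l)"
        by (simp add: sum.distrib sum_subtractf)
      finally show "0 < (\<Sum>l\<in>UNIV. real (v l) * monomial_blowup i j a $ l)"
        using less.prems(2) a by simp
    qed
    ultimately obtain ps where "blowup_sequence ps"
      "blowups ps ` (monomial_blowup i j ` E) \<subseteq> first_quadrant"
      using less.hyps[OF _ finite_imageI[OF less.prems(1)]] by meson
    with ij(1) show ?thesis
      by (intro exI[of _ "(i, j) # ps"]) (auto simp: image_subset_iff)
  next
    case False
    show ?thesis
    proof (cases "\<exists>k. 0 < w k")
      case True
      then obtain k where k: "0 < w k" by blast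
      \<comment> \<open>Of two positive weights, the smaller could still be subtracted from the
        other.\<close>
      have zero: "w l = 0" if "l \<noteq> k" for l
        using False k that by (metis bot_nat_0.not_eq_extremum linorder_le_cases)
      have "(\<Sum>l\<in>UNIV. real (w l) * a $ l) = real (w k) * a $ k" for a :: "real ^ 'n"
        by (subst sum.remove[of _ k]) (simp_all add: zero)
      then have "\<forall>a\<in>E. 0 < a $ k"
        using less.prems(2) k by (simp add: zero_less_mult_iff)
      with less.prems(1) show ?thesis by (rule blowups_nonneg_if_coordinate_pos)
    next
      case False
      then have "E = {}" using less.prems(2) by auto
      then show ?thesis by (intro exI[of _ "[]"]) simp
    qed
  qed
qed

text \<open>Scaling \<open>c\<close> by \<open>N\<close> and rounding down changes the pairing with
  \<open>a\<close> by at most the l1-norm \<open>S a\<close>, so it suffices that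
  \<open>N * (c \<bullet> a)\<close> exceeds \<open>S a\<close> on the finite set
  \<open>E\<close>.\<close>

lemma nat_weight_pos_if_weight_pos:
  fixes E :: "(real ^ 'n) set"
  assumes "finite E" "\<forall>l. 0 \<le> c $ l" "\<forall>a\<in>E. 0 < c \<bullet> a"
  shows "\<exists>w :: 'n \<Rightarrow> nat. \<forall>a\<in>E. 0 < (\<Sum>l\<in>UNIV. real (w l) * a $ l)"
proof (cases "E = {}")
  case False
  define S where "S a = (\<Sum>l\<in>UNIV. \<bar>a $ l\<bar>)" for a :: "real ^ 'n"
  obtain N :: nat where N: "Max ((\<lambda>a. S a / (c \<bullet> a)) ` E) < real N"
    using reals_Archimedean2 by blast
  define w where "w l = nat \<lfloor>real N * c $ l\<rfloor>" for l
  have "0 < (\<Sum>l\<in>UNIV. real (w l) * a $ l)" if a: "a \<in> E" for a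
  proof -
    have "S a / (c \<bullet> a) < real N"
      using N a assms(1) by (meson Max_ge finite_imageI imageI le_less_trans)
    then have "S a < real N * (c \<bullet> a)"
      using assms(3) a by (simp add: pos_divide_less_eq)
    also have "\<dots> = (\<Sum>l\<in>UNIV. real N * c $ l * a $ l)"
      by (simp add: inner_vec_def sum_distrib_left mult.assoc)
    also have "\<dots> \<le> (\<Sum>l\<in>UNIV. real (w l) * a $ l + \<bar>a $ l\<bar>)"
    proof (rule sum_mono)
      fix l
      have "0 \<le> real N * c $ l" using assms(2) by simp
      then have "real (w l) = of_int \<lfloor>real N * c $ l\<rfloor>" by (simp add: w_def)
      then have "\<bar>real N * c $ l - real (w l)\<bar> \<le> 1" by linarith
      then have "\<bar>(real N * c $ l - real (w l)) * a $ l\<bar> \<le> 1 * \<bar>a $ l\<bar>"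
        unfolding abs_mult by (intro mult_right_mono) auto
      then show "real N * c $ l * a $ l \<le> real (w l) * a $ l + \<bar>a $ l\<bar>"
        by (simp add: algebra_simps)
    qed
    finally show ?thesis by (simp add: S_def sum.distrib)
  qed
  then show ?thesis by blast
qed simp

text \<open>Strict separation of the compact set from the closed convex cone of non-positive
  vectors. As the cone contains 0, the separating level \<open>b\<close> is positive.\<close>

lemma weight_pos_if_disjoint:
  fixes K :: "(real ^ 'n) set"
  assumes "convex K" "compact K" "K \<inter> uminus ` first_quadrant = {}"
  shows "\<exists>c. (\<forall>l. 0 \<le> c $ l) \<and> (\<forall>a\<in>K. 0 < c \<bullet> a)"
proof (cases "K = {}")
  case False
  let ?Q = "uminus ` first_quadrant :: (real ^ 'n) set"
  have Q: "?Q = {x. \<forall>l. x $ l \<le> 0}"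
  proof (intro set_eqI iffI)
    fix x :: "real ^ 'n" assume "x \<in> {x. \<forall>l. x $ l \<le> 0}"
    then have "- x \<in> first_quadrant" by (simp add: first_quadrant_def)
    then show "x \<in> ?Q" by (metis imageI minus_minus)
  qed (auto simp: first_quadrant_def)
  have "convex ?Q"
    unfolding Q by (auto simp: convex_def intro!: add_nonpos_nonpos mult_nonneg_nonpos)
  moreover have "closed ?Q"
    unfolding Q by (intro closed_Collect_all closed_Collect_le continuous_intros)
  ultimately obtain c b where c: "\<forall>x\<in>?Q. c \<bullet> x < b" "\<forall>x\<in>K. b < c \<bullet> x"
    using separating_hyperplane_closed_compact[of ?Q K] assms False by (metis Int_commute)
  have "0 \<in> ?Q" by (simp add: Q)
  with c(1) have b: "0 < b" by force
  have "0 \<le> c $ l" for l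
  proof (rule ccontr)
    assume neg: "\<not> 0 \<le> c $ l"
    \<comment> \<open>For negative \<open>c $ l\<close> this point of the cone would attain exactly
      the level \<open>b\<close>, against strictness.\<close>
    then have "axis l (b / c $ l) \<in> ?Q"
      using b by (auto simp: Q axis_def divide_nonneg_neg)
    with c(1) have "c \<bullet> axis l (b / c $ l) < b" by blast
    with neg show False by (simp add: inner_axis)
  qed
  with c(2) b show ?thesis by (meson less_trans)
qed (auto intro: exI[of _ 0])

theorem theorem1p5:
  fixes E H :: "(real ^ 'n) set"
  assumes "finite E"
    and "is_hyperplane H"
    and "affine hull E = H"
    and "0 \<notin> H"
  shows "(\<exists>ps. blowup_sequence ps \<and>
            blowup_transform ps (pyramid (convex hull E)) \<subseteq> first_quadrant)
         \<longleftrightarrow> pyramid (convex hull E) \<inter> uminus ` first_quadrant = {0}"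
proof
  obtain c b where "c \<noteq> 0" and H: "H = {x. c \<bullet> x = b}"
    using assms(2) unfolding is_hyperplane_def by blast
  \<comment> \<open>The foot of the perpendicular from the origin shows that \<open>H\<close>, and
    with it \<open>E\<close>, is non-empty.\<close>
  then have "(b / (c \<bullet> c)) *\<^sub>R c \<in> H" by simp
  then have ne: "E \<noteq> {}" using assms(3) by auto
  assume "\<exists>ps. blowup_sequence ps \<and>
            blowup_transform ps (pyramid (convex hull E)) \<subseteq> first_quadrant"
  then obtain ps where ps: "blowup_sequence ps"
    "\<forall>x\<in>pyramid (convex hull E). blowups ps x \<in> first_quadrant"
    unfolding blowup_transform_def by blast
  have "x = 0" if x: "x \<in> pyramid (convex hull E)" "x \<in> uminus ` first_quadrant" for x
  proof (rule ccontr)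
    assume "x \<noteq> 0"
    moreover have "\<forall>l. x $ l \<le> 0" using x(2) by (auto simp: first_quadrant_def)
    ultimately have nonpos: "\<forall>l. blowups ps x $ l \<le> 0" and "blowups ps x \<noteq> 0"
      using blowups_nonpos ps(1) by blast+
    moreover have "\<forall>l. 0 \<le> blowups ps x $ l"
      using ps(2) x(1) by (auto simp: first_quadrant_def)
    ultimately show False by (simp add: vec_eq_iff order_antisym)
  qed
  moreover have "0 \<in> pyramid (convex hull E)"
    using ne by (force simp: pyramid_convex_hull_finite[OF assms(1)] intro: exI[of _ "\<lambda>_. 0"])
  moreover have "0 \<in> uminus ` (first_quadrant :: (real ^ 'n) set)"
    by (force simp: first_quadrant_def)
  ultimately show "pyramid (convex hull E) \<inter> uminus ` first_quadrant = {0}" by blast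
next
  assume *: "pyramid (convex hull E) \<inter> uminus ` first_quadrant = {0}"
  have "E \<noteq> {}" using * by (auto simp: pyramid_def)
  \<comment> \<open>The convex hull lies in \<open>H\<close>, which misses the origin, the only
    point that the pyramid shares with the negative quadrant.\<close>
  have "0 \<notin> convex hull E"
    using assms(3,4) convex_hull_subset_affine_hull by blast
  moreover have "convex hull E \<subseteq> pyramid (convex hull E)"
    unfolding pyramid_eq_conic_hull by (rule hull_subset)
  ultimately have "convex hull E \<inter> uminus ` first_quadrant = {}"
    unfolding disjoint_iff using * by (metis IntI singletonD subsetD)
  with assms(1) obtain c where "\<forall>l. 0 \<le> c $ l" "\<forall>a\<in>convex hull E. 0 < c \<bullet> a"
    using weight_pos_if_disjoint[OF convex_convex_hull finite_imp_compact_convex_hull] by metis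
  then obtain w :: "'n \<Rightarrow> nat" where "\<forall>a\<in>E. 0 < (\<Sum>l\<in>UNIV. real (w l) * a $ l)"
    using nat_weight_pos_if_weight_pos[OF assms(1)] by (meson hull_inc)
  with assms(1) obtain ps where ps: "blowup_sequence ps" "blowups ps ` E \<subseteq> first_quadrant"
    using blowups_nonneg_if_weight_pos by blast
  \<comment> \<open>By linearity, non-negativity passes from the generators to their non-negative
    combinations.\<close>
  have "blowups ps x \<in> first_quadrant" if x: "x \<in> pyramid (convex hull E)" for x
  proof -
    obtain u where u: "\<forall>a\<in>E. 0 \<le> u a" "x = (\<Sum>a\<in>E. u a *\<^sub>R a)"
      using x pyramid_convex_hull_finite[OF assms(1) \<open>E \<noteq> {}\<close>] by blast
    have "blowups ps x = (\<Sum>a\<in>E. u a *\<^sub>R blowups ps a)"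
      by (simp add: u(2) linear_sum[OF linear_blowups] linear_cmul[OF linear_blowups])
    with u(1) ps(2) show ?thesis
      by (auto simp: first_quadrant_def image_subset_iff intro!: sum_nonneg)
  qed
  with ps(1) show "\<exists>ps. blowup_sequence ps \<and>
            blowup_transform ps (pyramid (convex hull E)) \<subseteq> first_quadrant"
    unfolding blowup_transform_def by blast
qed

end
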